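(* There does not exist a graph $G$ such that $\mathscr{Z}(G)=K_{1,r}$ for some $r\ge 2$.
   Context: All graphs are finite, simple and undirected (with nonempty vertex set, not necessarily connected); equality of graphs here means isomorphism. $K_{1,r}$ is the star with $r$ leaves. Zero forcing: vertices of a graph $G$ are colored blue or white; the color change rule says that a blue vertex $u$ can change the color of a white vertex $w$ to blue if $w$ is the unique white neighbor of $u$. A set $B\subseteq V(G)$ is a zero forcing set of $G$ if, starting with exactly the vertices of $B$ blue and applying the color change rule repeatedly, all vertices eventually become blue. The zero forcing number $\operatorname{Z}(G)$ is the minimum of $|B|$ over all zero forcing sets $B$ of $G$; a minimum zero forcing set is a zero forcing set $B$ with $|B|=\operatorname{Z}(G)$. The zero forcing graph $\mathscr{Z}(G)$ is the graph whose vertices are the minimum zero forcing sets of $G$, with two of them adjacent if and only if their symmetric difference has exactly two elements. *)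

theory Defs
  imports "Graph_Theory.Graph_Theory"
begin

text \<open>
  Finite simple undirected graphs are the symmetric loop-free finite digraphs of
  \<^locale>\<open>pair_graph\<close>: an edge \<open>uv\<close> is represented by the two arcs \<open>(u, v)\<close> and \<open>(v, u)\<close>.
\<close>

text \<open>One application of the color change rule; a coloring is given by its set of blue vertices.\<close>

inductive color_change :: "'a pair_pre_digraph \<Rightarrow> 'a set \<Rightarrow> 'a set \<Rightarrow> bool" for G where
  "u \<in> S \<Longrightarrow> {x \<in> pverts G. (u, x) \<in> parcs G \<and> x \<notin> S} = {w}
    \<Longrightarrow> color_change G S (insert w S)"

definition zero_forcing_set :: "'a pair_pre_digraph \<Rightarrow> 'a set \<Rightarrow> bool" where
  "zero_forcing_set G B \<longleftrightarrow> B \<subseteq> pverts G \<and> (color_change G)\<^sup>*\<^sup>* B (pverts G)"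

definition zero_forcing_number :: "'a pair_pre_digraph \<Rightarrow> nat" where
  "zero_forcing_number G = Min {card B | B. zero_forcing_set G B}"

definition min_zero_forcing_set :: "'a pair_pre_digraph \<Rightarrow> 'a set \<Rightarrow> bool" where
  "min_zero_forcing_set G B \<longleftrightarrow> zero_forcing_set G B \<and> card B = zero_forcing_number G"

definition zero_forcing_graph :: "'a pair_pre_digraph \<Rightarrow> 'a set pair_pre_digraph" where
  "zero_forcing_graph G =
    \<lparr> pverts = {B. min_zero_forcing_set G B},
      parcs = {(A, B). min_zero_forcing_set G A \<and> min_zero_forcing_set G B
                 \<and> card (sym_diff A B) = 2} \<rparr>"

text \<open>
  Since \<^const>\<open>complete_bipartite_digraph\<close> contains the condition of being a graph, the
  following fact is what makes it meaningful to ask whether a zero forcing graph is a star.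
\<close>

lemma pair_graph_zero_forcing_graph:
  assumes "finite (pverts G)"
  shows "pair_graph (zero_forcing_graph G)"
proof -
  have "{B. min_zero_forcing_set G B} \<subseteq> Pow (pverts G)"
    by (auto simp: min_zero_forcing_set_def zero_forcing_set_def)
  then have fin: "finite {B. min_zero_forcing_set G B}"
    using assms by (meson finite_Pow_iff finite_subset)
  have "parcs (zero_forcing_graph G)
      \<subseteq> {B. min_zero_forcing_set G B} \<times> {B. min_zero_forcing_set G B}"
    by (auto simp: zero_forcing_graph_def)
  then have "finite (parcs (zero_forcing_graph G))"
    using fin by (meson finite_SigmaI finite_subset)
  with fin show ?thesis
    by unfold_locales
      (auto simp: zero_forcing_graph_def symmetric_def Un_commute intro!: symI)
qed

end

theory Submission
  imports Defs
begin

text \<open>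
  The final vertices of the forcing chains of a minimum zero forcing set form another minimum zero
  forcing set (run the forces backwards). If \<open>C\<close> is the center of a star, then this reversal
  differs from \<open>C\<close> in at most one vertex, so every run from \<open>C\<close> has exactly one nontrivial chain.
  Let it start at \<open>b\<close>. A vertex \<open>w\<close> of \<open>W = C - {b}\<close> with a neighbor outside \<open>C\<close> would be able to
  force its last such neighbor: this either opens a second nontrivial chain, or it replaces the
  first force of \<open>b\<close> and yields a leaf adjacent to the reversal of \<open>C\<close>. Minimality of \<open>C\<close>
  excludes edges inside \<open>C\<close>, so \<open>W\<close> consists of isolated vertices. Hence every minimum zero forcing
  set is \<open>W\<close> plus one vertex, and any two of them are adjacent.
\<close>

section \<open>Forces and the ends of forcing chains\<close>

definition can_force :: "'a pair_pre_digraph \<Rightarrow> 'a set \<Rightarrow> 'a \<Rightarrow> 'a \<Rightarrow> bool" where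
  "can_force G S u w \<longleftrightarrow>
    u \<in> S \<and> w \<notin> S \<and> (u, w) \<in> parcs G \<and> (\<forall>x. (u, x) \<in> parcs G \<longrightarrow> x \<notin> S \<longrightarrow> x = w)"

text \<open>
  \<open>S\<close> is the set of blue vertices reached from \<open>B\<close>, and \<open>A\<close> is the set of current ends of the
  forcing chains.
\<close>

inductive forcing_run :: "'a pair_pre_digraph \<Rightarrow> 'a set \<Rightarrow> 'a set \<Rightarrow> 'a set \<Rightarrow> bool" for G B where
  start: "forcing_run G B B B"
| force: "forcing_run G B S A \<Longrightarrow> can_force G S u w
    \<Longrightarrow> forcing_run G B (insert w S) (insert w (A - {u}))"

lemma forcing_run_subset: "forcing_run G B S A \<Longrightarrow> B \<subseteq> S \<and> A \<subseteq> S"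
  by (induction rule: forcing_run.induct) auto

text \<open>A vertex leaves \<open>A\<close> only by forcing, and that force turns its last white
  neighbor blue.\<close>

lemma forcing_run_inactive:
  "forcing_run G B S A \<Longrightarrow> x \<in> S - A \<Longrightarrow> (x, y) \<in> parcs G \<Longrightarrow> y \<in> S"
  by (induction arbitrary: x y rule: forcing_run.induct) (auto simp: can_force_def)

lemma can_force_active: "forcing_run G B S A \<Longrightarrow> can_force G S u w \<Longrightarrow> u \<in> A"
  using forcing_run_inactive[of G B S A u w] by (auto simp: can_force_def)

text \<open>Each force trades the end \<open>u\<close> for \<open>w\<close>, which is still white
  and hence not yet in \<open>A\<close>.\<close>

lemma forcing_run_card:
  assumes "forcing_run G B S A" "finite B"
  shows "finite A \<and> card A = card B"
  using assms
proof (induction rule: forcing_run.induct)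
  case (force S A u w)
  have "u \<in> A" using can_force_active force by metis
  moreover have "w \<notin> A" using force forcing_run_subset can_force_def by (metis subsetD)
  ultimately show ?case using force
    by (metis card.remove card_insert_disjoint finite_insert finite_Diff Diff_iff)
qed simp

section \<open>Zero forcing sets and reversal\<close>

context pair_graph
begin

lemma arc_sym: "(u, v) \<in> parcs G \<Longrightarrow> (v, u) \<in> parcs G"
  using pair_sym_arcs unfolding symmetric_def by (auto elim: symE)

text \<open>\<open>can_force\<close> names the forcing vertex, so that chains can be tracked; arcs
  end in vertices, so both notions see the same white neighbors.\<close>

lemma color_change_iff: "color_change G S T \<longleftrightarrow> (\<exists>u w. can_force G S u w \<and> T = insert w S)"
proof
  assume "color_change G S T"
  then obtain u w where "u \<in> S" "T = insert w S"
    and *: "{x \<in> pverts G. (u, x) \<in> parcs G \<and> x \<notin> S} = {w}"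
    by cases auto
  moreover have "w \<in> {x \<in> pverts G. (u, x) \<in> parcs G \<and> x \<notin> S}" using * by simp
  moreover have "x = w" if "(u, x) \<in> parcs G" "x \<notin> S" for x
  proof -
    have "x \<in> {x \<in> pverts G. (u, x) \<in> parcs G \<and> x \<notin> S}" using that in_arcsD2 by auto
    then show ?thesis unfolding * by simp
  qed
  ultimately show "\<exists>u w. can_force G S u w \<and> T = insert w S" unfolding can_force_def by blast
next
  assume "\<exists>u w. can_force G S u w \<and> T = insert w S"
  then obtain u w where *: "can_force G S u w" "T = insert w S" by blast
  then have "{x \<in> pverts G. (u, x) \<in> parcs G \<and> x \<notin> S} = {w}"
    using in_arcsD2 by (auto simp: can_force_def)
  then show "color_change G S T"
    using * color_change.intros[of u S G w] by (simp add: can_force_def)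
qed

lemma can_force_color_change: "can_force G S u w \<Longrightarrow> color_change G S (insert w S)"
  by (auto simp: color_change_iff)

lemma color_changeE:
  assumes "color_change G S T"
  obtains u w where "can_force G S u w" "T = insert w S"
  using assms by (auto simp: color_change_iff)

text \<open>A force available from the smaller set either stays available from the larger one or has
  a target that is already blue.\<close>

lemma color_change_mono:
  assumes "(color_change G)\<^sup>*\<^sup>* S (pverts G)" "S \<subseteq> T" "T \<subseteq> pverts G"
  shows "(color_change G)\<^sup>*\<^sup>* T (pverts G)"
  using assms
proof (induction arbitrary: T rule: converse_rtranclp_induct)
  case base
  then show ?case by simp
next
  case (step S S')
  obtain u w where uw: "can_force G S u w" "S' = insert w S"
    using step.hyps by (elim color_changeE)
  show ?case
  proof (cases "w \<in> T")
    case True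
    then show ?thesis using step.IH step.prems uw by simp
  next
    case False
    then have "can_force G T u w" using uw step.prems by (auto simp: can_force_def)
    moreover have "(color_change G)\<^sup>*\<^sup>* (insert w T) (pverts G)"
      using uw step.prems in_arcsD2 by (intro step.IH) (auto simp: can_force_def)
    ultimately show ?thesis
      using can_force_color_change converse_rtranclp_into_rtranclp by metis
  qed
qed

lemma zero_forcing_set_unforce:
  assumes "zero_forcing_set G (insert w S)" "can_force G S u w"
  shows "zero_forcing_set G S"
  using assms can_force_color_change converse_rtranclp_into_rtranclp
  unfolding zero_forcing_set_def by (metis insert_subset)

text \<open>Counting the vertices not yet reached as blue makes induction along the run possible; at
  the full vertex set only \<open>A\<close> remains.\<close>

lemma reversal_zero_forcing:
  assumes "forcing_run G B S A" "S \<subseteq> pverts G"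
  shows "zero_forcing_set G (A \<union> (pverts G - S))"
  using assms
proof (induction rule: forcing_run.induct)
  case start
  then have "B \<union> (pverts G - B) = pverts G" by auto
  then show ?case by (simp add: zero_forcing_set_def)
next
  case (force S A u w)
  let ?T = "insert w (A - {u}) \<union> (pverts G - insert w S)"
  have u: "u \<in> A" using can_force_active force by metis
  have AS: "A \<subseteq> S" using force forcing_run_subset by metis
  have wS: "w \<notin> S" "w \<in> pverts G" using force by (auto simp: can_force_def)
  have eq: "insert u ?T = A \<union> (pverts G - S)" using u wS by auto
  \<comment> \<open>The latest force is undone first: any other white neighbor of \<open>w\<close>
    would be an inactive vertex of \<open>S\<close> with the neighbor \<open>w\<close> outside
    \<open>S\<close>.\<close>
  have "can_force G ?T w u"
    unfolding can_force_def
  proof (intro conjI allI impI)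
    show "u \<notin> ?T" using u AS wS by auto
    show "(w, u) \<in> parcs G" using force arc_sym by (auto simp: can_force_def)
    fix x assume x: "(w, x) \<in> parcs G" "x \<notin> ?T"
    show "x = u"
    proof (rule ccontr)
      assume "x \<noteq> u"
      then have "x \<in> S - A" using x in_arcsD2 by auto
      then show False
        using forcing_run_inactive[OF force.hyps(1)] arc_sym x wS by blast
    qed
  qed simp
  moreover have "zero_forcing_set G (insert u ?T)" unfolding eq using force by auto
  ultimately show ?case using zero_forcing_set_unforce by blast
qed

text \<open>Later forces add only vertices outside \<open>S\<close> to the ends, so a vertex of
  \<open>S\<close> that has stopped being an end never becomes one again.\<close>

lemma forcing_run_extend:
  assumes "(color_change G)\<^sup>*\<^sup>* S T" "forcing_run G B S A"
  shows "\<exists>A'. forcing_run G B T A' \<and> A' \<inter> S \<subseteq> A \<and> S \<subseteq> T"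
  using assms
proof (induction rule: rtranclp_induct)
  case base
  then show ?case by auto
next
  case (step T T')
  obtain A' where A': "forcing_run G B T A'" "A' \<inter> S \<subseteq> A" "S \<subseteq> T" using step by blast
  obtain u w where uw: "can_force G T u w" "T' = insert w T"
    using step.hyps by (elim color_changeE)
  have "forcing_run G B T' (insert w (A' - {u}))" using uw A' forcing_run.force by metis
  moreover have "insert w (A' - {u}) \<inter> S \<subseteq> A" using A' uw by (auto simp: can_force_def)
  ultimately show ?case using A' uw by (meson subset_insertI2)
qed

lemma zero_forcing_number_le:
  assumes "zero_forcing_set G B"
  shows "zero_forcing_number G \<le> card B"
proof -
  have "{card B | B. zero_forcing_set G B} \<subseteq> card ` Pow (pverts G)"
    by (auto simp: zero_forcing_set_def)
  then have "finite {card B | B. zero_forcing_set G B}"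
    using pair_finite_verts by (meson finite_Pow_iff finite_imageI finite_subset)
  then show ?thesis unfolding zero_forcing_number_def using assms by (intro Min_le) auto
qed

lemma min_zero_forcing_set_finite: "min_zero_forcing_set G B \<Longrightarrow> finite B"
  using pair_finite_verts
  by (auto simp: min_zero_forcing_set_def zero_forcing_set_def intro: finite_subset)

lemma min_zero_forcing_set_reversal:
  assumes "min_zero_forcing_set G B" "forcing_run G B (pverts G) A"
  shows "min_zero_forcing_set G A"
  using assms reversal_zero_forcing[OF assms(2)]
    forcing_run_card[OF assms(2) min_zero_forcing_set_finite[OF assms(1)]]
  by (simp add: min_zero_forcing_set_def)

text \<open>Otherwise \<open>w\<close> is redundant: without it, \<open>u\<close> could force it in
  the first step.\<close>

lemma min_zero_forcing_set_independent:
  assumes "min_zero_forcing_set G B" "u \<in> B" "w \<in> B" "\<And>x. (u, x) \<in> parcs G \<Longrightarrow> x \<in> B"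
  shows "(u, w) \<notin> parcs G"
proof
  assume uw: "(u, w) \<in> parcs G"
  then have "u \<noteq> w" using pair_no_loops by fastforce
  then have "can_force G (B - {w}) u w" using uw assms by (auto simp: can_force_def)
  moreover have "insert w (B - {w}) = B" using assms by auto
  ultimately have "zero_forcing_set G (B - {w})"
    using assms zero_forcing_set_unforce min_zero_forcing_set_def by metis
  then have "card B \<le> card (B - {w})"
    using assms zero_forcing_number_le min_zero_forcing_set_def by metis
  moreover have "card (B - {w}) < card B"
    using assms min_zero_forcing_set_finite by (meson card_Diff1_less)
  ultimately show False by simp
qed

lemma isolated_in_zero_forcing_set:
  assumes "zero_forcing_set G B" "w \<in> pverts G" "\<And>x. (w, x) \<notin> parcs G"
  shows "w \<in> B"
proof (rule ccontr)
  assume "w \<notin> B"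
  have "w \<notin> T" if "(color_change G)\<^sup>*\<^sup>* B T" for T
    using that
  proof (induction rule: rtranclp_induct)
    case base
    then show ?case by fact
  next
    case (step T T')
    then show ?case using arc_sym assms(3) by (auto simp: can_force_def color_change_iff)
  qed
  then show False using assms by (auto simp: zero_forcing_set_def)
qed

end

section \<open>Impossibility of a star center\<close>

lemma card_sym_diff_2_diff:
  assumes "finite A" "finite B" "card A = card B" "card (sym_diff A B) = 2"
  shows "card (A - B) = 1"
proof -
  have "card (A - B) = card (B - A)"
    using assms(1-3) by (metis card_Diff_subset_Int finite_Int inf_commute)
  moreover have "card (sym_diff A B) = card (A - B) + card (B - A)"
    using assms by (intro card_Un_disjoint) auto
  ultimately show ?thesis using assms(4) by simp
qed

text \<open>\<open>near\<close> limits every run from \<open>C\<close> to one nontrivial chain;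
  \<open>far\<close> rules out a second choice for the first force and, at the end, the pair
  \<open>B1\<close>, \<open>B2\<close>.\<close>

lemma (in pair_graph) no_star_center:
  assumes C: "min_zero_forcing_set G C"
    and near: "\<And>B. min_zero_forcing_set G B \<Longrightarrow> B \<noteq> C \<Longrightarrow> card (sym_diff C B) = 2"
    and far: "\<And>B B'. min_zero_forcing_set G B \<Longrightarrow> B \<noteq> C \<Longrightarrow> min_zero_forcing_set G B'
      \<Longrightarrow> B' \<noteq> C \<Longrightarrow> card (sym_diff B B') \<noteq> 2"
    and B1: "min_zero_forcing_set G B1" "B1 \<noteq> C"
    and B2: "min_zero_forcing_set G B2" "B2 \<noteq> C" "B1 \<noteq> B2"
  shows False
proof -
  let ?V = "pverts G"
  have CV: "C \<subseteq> ?V" "(color_change G)\<^sup>*\<^sup>* C ?V"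
    using C by (auto simp: min_zero_forcing_set_def zero_forcing_set_def)
  have finC: "finite C" using C min_zero_forcing_set_finite by blast
  have card_eq: "card B = card C" if "min_zero_forcing_set G B" for B
    using that C by (simp add: min_zero_forcing_set_def)
  have complete: "(color_change G)\<^sup>*\<^sup>* S ?V" if "C \<subseteq> S" "S \<subseteq> ?V" for S
    using that CV color_change_mono by blast
  have step_V: "w \<in> ?V" if "can_force G S u w" for S u w
    using that in_arcsD2 by (auto simp: can_force_def)
  \<comment> \<open>Both vertices have forced, so they stay missing from the reversal of a completed
    run, which by \<open>near\<close> misses just one vertex of \<open>C\<close>.\<close>
  have one_chain: "x = y"
    if run: "forcing_run G C S A" and "S \<subseteq> ?V" and x: "x \<in> C" "x \<notin> A" and y: "y \<in> C" "y \<notin> A"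
    for S A x y
  proof -
    have CS: "C \<subseteq> S" using run forcing_run_subset by metis
    then obtain A' where A': "forcing_run G C ?V A'" "A' \<inter> S \<subseteq> A"
      using forcing_run_extend[OF complete run] \<open>S \<subseteq> ?V\<close> by blast
    have xy: "x \<in> C - A'" "y \<in> C - A'" using x y A' CS by auto
    have min: "min_zero_forcing_set G A'" using min_zero_forcing_set_reversal[OF C A'(1)] .
    have "card (C - A') = 1"
      using card_sym_diff_2_diff[OF finC min_zero_forcing_set_finite[OF min]] card_eq[OF min]
        near[OF min] xy by auto
    then show ?thesis using xy by (metis card_1_singletonE singletonD)
  qed

  have "C \<noteq> ?V"
  proof
    assume "C = ?V"
    then have "B1 \<subseteq> C" using B1 by (auto simp: min_zero_forcing_set_def zero_forcing_set_def)
    then show False using B1 card_eq finC card_subset_eq by metis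
  qed
  then obtain S1 where "color_change G C S1"
    using CV by (meson converse_rtranclpE)
  then obtain b v where bv: "can_force G C b v" and S1: "S1 = insert v C"
    by (rule color_changeE)
  define W where "W = C - {b}"
  have bC: "b \<in> C" and vC: "v \<notin> C" using bv by (auto simp: can_force_def)
  have S1V: "S1 \<subseteq> ?V" using S1 bv step_V CV by auto
  have run1: "forcing_run G C S1 (insert v W)"
    using forcing_run.force[OF forcing_run.start bv] by (simp add: S1 W_def)

  \<comment> \<open>Invariant after the first force: only the chain of \<open>b\<close> grows, with
    current end \<open>t\<close>; a vertex \<open>w\<close> able to force \<open>v\<close> could
    have replaced \<open>b\<close>, leaving \<open>b\<close> as an end instead of \<open>w\<close>;
    a vertex of \<open>W\<close> with white neighbors never sees them all turn blue.\<close>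
  have single: "\<exists>t. t \<notin> C \<and> S \<subseteq> ?V \<and> forcing_run G C S (insert t W)
      \<and> (\<forall>w\<in>W. can_force G C w v \<longrightarrow> forcing_run G C S (insert t (C - {w})))
      \<and> (\<forall>w\<in>W. \<forall>x. (w, x) \<in> parcs G \<longrightarrow> x \<notin> S1 \<longrightarrow> (\<exists>y. (w, y) \<in> parcs G \<and> y \<notin> S))"
    if "(color_change G)\<^sup>*\<^sup>* S1 S" for S
    using that
  proof (induction rule: rtranclp_induct)
    case base
    have "forcing_run G C S1 (insert v (C - {w}))" if "can_force G C w v" for w
      using forcing_run.force[OF forcing_run.start that] by (simp add: S1)
    then show ?case using vC run1 S1V by blast
  next
    case (step S S')
    then obtain t where t: "t \<notin> C" "S \<subseteq> ?V" "forcing_run G C S (insert t W)"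
      and alt: "\<And>w. w \<in> W \<Longrightarrow> can_force G C w v \<Longrightarrow> forcing_run G C S (insert t (C - {w}))"
      and out: "\<And>w x. w \<in> W \<Longrightarrow> (w, x) \<in> parcs G \<Longrightarrow> x \<notin> S1 \<Longrightarrow> \<exists>y. (w, y) \<in> parcs G \<and> y \<notin> S"
      by blast
    obtain u x where ux: "can_force G S u x" "S' = insert x S"
      using step.hyps by (elim color_changeE)
    have S'V: "S' \<subseteq> ?V" using ux t step_V by auto
    have CS: "C \<subseteq> S" using t forcing_run_subset by metis
    have xC: "x \<notin> C" using CS ux by (auto simp: can_force_def)
    have only_t: "u = t" if "can_force G S u x" for u
    proof (rule ccontr)
      assume "u \<noteq> t"
      then have "u \<in> W" using can_force_active[OF t(3) that] by simp
      moreover have "b = u"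
      \<comment> \<open>If \<open>u\<close> in \<open>W\<close> forced, both \<open>b\<close> and
        \<open>u\<close> would start nontrivial chains.\<close>
      proof (rule one_chain)
        show "forcing_run G C S' (insert x (insert t W - {u}))"
          unfolding ux(2) using forcing_run.force[OF t(3) that] .
      qed (use bC t xC S'V \<open>u \<in> W\<close> in \<open>auto simp: W_def\<close>)
      ultimately show False by (simp add: W_def)
    qed
    have u: "u = t" using only_t ux by blast
    have "forcing_run G C S' (insert x W)"
    proof -
      have "insert t W - {u} = W" using t u by (auto simp: W_def)
      then show ?thesis using forcing_run.force[OF t(3) ux(1)] by (simp add: ux)
    qed
    moreover have "forcing_run G C S' (insert x (C - {w}))" if "w \<in> W" "can_force G C w v" for w
    proof -
      have "insert t (C - {w}) - {u} = C - {w}" using t u by auto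
      then show ?thesis using forcing_run.force[OF alt[OF that] ux(1)] by (simp add: ux)
    qed
    moreover have "\<exists>y. (w, y) \<in> parcs G \<and> y \<notin> S'"
      if w: "w \<in> W" "(w, z) \<in> parcs G" "z \<notin> S1" for w z
    proof (rule ccontr)
      assume "\<not> ?thesis"
      moreover obtain y where "(w, y) \<in> parcs G" "y \<notin> S" using out w by blast
      \<comment> \<open>If \<open>x\<close> is the last white neighbor of \<open>w\<close>, then
        \<open>w\<close> could force it in place of \<open>t\<close>.\<close>
      ultimately have "can_force G S w x"
        using w CS ux by (auto simp: can_force_def W_def)
      then have "w = t" using only_t by blast
      then show False using w t by (auto simp: W_def)
    qed
    ultimately show ?case using xC S'V by blast
  qed
  obtain t where t: "t \<notin> C" "forcing_run G C ?V (insert t W)"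
    and alt: "\<And>w. w \<in> W \<Longrightarrow> can_force G C w v \<Longrightarrow> forcing_run G C ?V (insert t (C - {w}))"
    and out: "\<And>w x. w \<in> W \<Longrightarrow> (w, x) \<in> parcs G \<Longrightarrow> x \<notin> S1 \<Longrightarrow> \<exists>y. (w, y) \<in> parcs G \<and> y \<notin> ?V"
    using single[OF complete] S1 S1V by blast
  \<comment> \<open>In the completed run no vertex is white, so the third clause of the invariant
    leaves no neighbor outside \<open>S1\<close>.\<close>
  have inS1: "x \<in> S1" if "w \<in> W" "(w, x) \<in> parcs G" for w x
    using out that in_arcsD2 by blast
  have inC: "x \<in> C" if w: "w \<in> W" and x: "(w, x) \<in> parcs G" for w x
  proof (rule ccontr)
    assume "x \<notin> C"
    then have "can_force G C w v"
      using w x inS1 S1 by (auto simp: can_force_def W_def)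
    \<comment> \<open>Starting with \<open>w\<close> or with \<open>b\<close> gives two reversals;
      both contain \<open>t\<close>, so neither is \<open>C\<close>, yet they are adjacent.\<close>
    then have "min_zero_forcing_set G (insert t (C - {w}))"
      using alt w C min_zero_forcing_set_reversal by blast
    moreover have "min_zero_forcing_set G (insert t W)"
      using t C min_zero_forcing_set_reversal by blast
    moreover have "sym_diff (insert t W) (insert t (C - {w})) = {b, w}"
      using w t bC by (auto simp: W_def)
    moreover have "b \<noteq> w" using w by (auto simp: W_def)
    ultimately show False using far t by (metis card_2_iff insertI1)
  qed
  have isolated: "(w, x) \<notin> parcs G" if "w \<in> W" for w x
    using min_zero_forcing_set_independent[OF C] inC that by (metis DiffD1 W_def)

  \<comment> \<open>Isolated vertices cannot be forced, so every zero forcing set contains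
    \<open>W\<close>, and minimum size leaves room for one more vertex.\<close>
  have form: "\<exists>x. x \<notin> W \<and> B = insert x W" if B: "min_zero_forcing_set G B" for B
  proof -
    have "W \<subseteq> B"
    proof
      fix w assume "w \<in> W"
      moreover have "w \<in> ?V" using \<open>w \<in> W\<close> CV by (auto simp: W_def)
      moreover have "zero_forcing_set G B" using B by (simp add: min_zero_forcing_set_def)
      ultimately show "w \<in> B" using isolated isolated_in_zero_forcing_set by blast
    qed
    moreover have "finite W" using finC by (simp add: W_def)
    moreover have "card B = Suc (card W)"
      using card_eq[OF B] finC bC card.remove unfolding W_def by metis
    ultimately have "card (B - W) = 1"
      by (simp add: card_Diff_subset)
    then obtain x where "B - W = {x}" by (rule card_1_singletonE)
    then show ?thesis using \<open>W \<subseteq> B\<close> by (intro exI[of _ x]) auto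
  qed
  obtain x y where xy: "x \<notin> W" "B1 = insert x W" "y \<notin> W" "B2 = insert y W"
    using form B1 B2 by meson
  then have "sym_diff B1 B2 = {x, y}" "x \<noteq> y" using B2 by auto
  then show False using far B1 B2 by (metis card_2_iff)
qed

section \<open>Reading the star off the complete bipartite digraph\<close>

theorem proposition4p6:
  shows "\<not> (\<exists>(G :: 'a pair_pre_digraph) (r :: nat).
           pair_graph G \<and> pverts G \<noteq> {} \<and> r \<ge> 2
           \<and> K\<^bsub>1,r\<^esub> (with_proj (zero_forcing_graph G)))"
proof
  assume "\<exists>(G :: 'a pair_pre_digraph) (r :: nat).
           pair_graph G \<and> pverts G \<noteq> {} \<and> r \<ge> 2
           \<and> K\<^bsub>1,r\<^esub> (with_proj (zero_forcing_graph G))"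
  then obtain G :: "'a pair_pre_digraph" and r :: nat
    where G: "pair_graph G" and r: "r \<ge> 2" and K: "K\<^bsub>1,r\<^esub> (with_proj (zero_forcing_graph G))"
    by blast
  interpret pair_graph G by (rule G)
  obtain U L where UL: "pverts (zero_forcing_graph G) = U \<union> L" "U \<inter> L = {}" "card U = 1"
      "card L = r" "parcs (zero_forcing_graph G) = U \<times> L \<union> L \<times> U"
    using K unfolding complete_bipartite_digraph_pair_def by blast
  obtain C where U: "U = {C}" using UL(3) by (rule card_1_singletonE)
  have min: "min_zero_forcing_set G B \<longleftrightarrow> B = C \<or> B \<in> L" for B
    using UL(1) unfolding U by (auto simp: zero_forcing_graph_def)
  have adj: "min_zero_forcing_set G A \<and> min_zero_forcing_set G B \<and> card (sym_diff A B) = 2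
      \<longleftrightarrow> A = C \<and> B \<in> L \<or> A \<in> L \<and> B = C" for A B
  proof -
    have "(A, B) \<in> parcs (zero_forcing_graph G) \<longleftrightarrow> (A, B) \<in> {C} \<times> L \<union> L \<times> {C}"
      using UL(5) U by simp
    then show ?thesis by (simp add: zero_forcing_graph_def)
  qed
  \<comment> \<open>Here \<open>r \<ge> 2\<close> supplies two distinct leaves.\<close>
  obtain L' where "L' \<subseteq> L" "card L' = 2"
    using r UL(4) by (metis obtain_subset_with_card_n)
  then obtain B1 B2 where B: "B1 \<in> L" "B2 \<in> L" "B1 \<noteq> B2" by (auto simp: card_2_iff)
  have CL: "C \<notin> L" using UL(2) U by simp
  show False
  proof (rule no_star_center)
    show "min_zero_forcing_set G C" "min_zero_forcing_set G B1" "min_zero_forcing_set G B2"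
      using min B by auto
    show "B1 \<noteq> C" "B2 \<noteq> C" "B1 \<noteq> B2" using B CL by auto
    show "card (sym_diff C B) = 2" if "min_zero_forcing_set G B" "B \<noteq> C" for B
      using that min adj by blast
    show "card (sym_diff B B') \<noteq> 2" if "min_zero_forcing_set G B" "B \<noteq> C"
      "min_zero_forcing_set G B'" "B' \<noteq> C" for B B'
      using that adj by blast
  qed
qed

end
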